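(* Let $V:[-1,1]\times[t_0,t_1]\to so(3)$ be a variation through Lie quadratics of the nonzero constant $V_0=D$, as specified in the context, and let $\delta\in(0,1)$. The first order approximate quadratic of $V$ has the form $$\hat V_1(t)=D+\delta\big(q(t)F_0+A_0+(t-t_0)A_1+\tilde e(t)(B)\big),$$ where $q(t)=c_0+c_1(t-t_0)+c_2(t-t_0)^2$ with $c_0,c_1,c_2\in\mathbb{R}$, and $A_0,A_1,B\in F_0^\perp$. Then, for every integer $j\ge0$ and all $t\in[t_0,t_1]$, $$V_\delta^{(j)}(t)=\hat V_1^{(j)}(t)+O(\delta^2),$$ where the asymptotic constants depend only on $d,t_0,t_1$ and $j$.
   Context: Superscript $(j)$ denotes the $j$-th derivative in $t$; for a function of $(h,t)$, $V^{(i,j)}$ denotes $i$ derivatives in $h$ and $j$ in $t$. Throughout $t_0<t_1$. Euclidean space $E^3$ is a Lie algebra with the cross product; the isomorphism $\mathrm{ad}:E^3\to so(3)$, $\mathrm{ad}(v)(w)=v\times w$, identifies $E^3$ with $so(3)$, and $so(3)$ carries the inner product $\langle\,,\rangle$ making $\mathrm{ad}$ an isometry. A smooth curve $U:[t_0,t_1]\to so(3)$ is a Lie quadratic when $U^{(2)}=[U^{(1)},U]+C$ for some constant $C\in so(3)$ (equivalently $U^{(3)}=[U^{(2)},U]$). Variation. $V:[-1,1]\times[t_0,t_1]\to so(3)$ is $C^\infty$; $V_h:=V(h,\cdot)$ is a Lie quadratic for every $h\in[-1,1]$; $V_0$ is a nonzero constant $D$; and $h\mapsto V(h,t_0)$ is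 an affine function of uniform norm $\le 1$. Notation. $d:=\|D\|$, $F_0:=D/d$, $F_0^\perp$ is the orthogonal complement of $F_0$ in $so(3)$, and $\tilde e(t):=\exp(-d(t-t_0)\,\mathrm{ad}(F_0))$, a linear endomorphism of $so(3)$, where here $\mathrm{ad}(F_0)=[F_0,\cdot]$. First order approximate quadratic: for $\delta\in(0,1)$, $\hat V_1(t):=V_0(t)+\delta V^{(1,0)}(0,t)$.
   Formalization: The asymptotic constants depend on d, t_0, t_1, j and also, monotonically, on the supremum over h and i,k in {1,2} of ||V^{(i,k)}(h,t_0)||; without this the claim fails, e.g. for V(h,t)=(1+c h^2(t-t_0))D with d<=1 and c arbitrarily large. *)

theory Defs
  imports "HOL-Analysis.Analysis"
begin

text \<open>
  The Lie algebra so(3) is identified with Euclidean space \<^typ>\<open>real^3\<close> via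
  \<open>ad v w = v \<times> w\<close>: the bracket \<open>[u, v]\<close> is \<^term>\<open>cross3 u v\<close>, and since \<open>ad\<close> is an
  isometry by definition of the inner product on so(3), the inner product is that of
  \<^typ>\<open>real^3\<close>. The lemmas below record that \<open>ad\<close> is an isomorphism of Lie algebras onto
  the skew-symmetric endomorphisms.
\<close>

definition ad :: "real^3 \<Rightarrow> real^3 \<Rightarrow> real^3" where
  "ad v = (\<lambda>w. cross3 v w)"

definition so3 :: "(real^3 \<Rightarrow> real^3) set" where
  "so3 = {L. linear L \<and> (\<forall>x y. L x \<bullet> y = - (x \<bullet> L y))}"

lemma ad_linear_combination: "ad (a *\<^sub>R u + b *\<^sub>R v) w = a *\<^sub>R ad u w + b *\<^sub>R ad v w"
  by (simp add: ad_def cross3_def vec_eq_iff forall_3 algebra_simps)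

lemma ad_bracket: "ad (cross3 u v) = (ad u \<circ> ad v) - (ad v \<circ> ad u)"
  by (rule ext) (simp add: ad_def cross3_def vec_eq_iff forall_3 algebra_simps)

lemma bij_betw_ad_so3: "bij_betw ad UNIV so3"
  unfolding bij_betw_def
proof
  show "inj ad"
  proof (rule injI)
    fix u v :: "real^3" assume "ad u = ad v"
    then have "cross3 u w = cross3 v w" for w by (simp add: ad_def fun_eq_iff)
    from this[of "axis 1 1"] this[of "axis 2 1"] show "u = v"
      by (simp add: cross3_def vec_eq_iff forall_3 axis_def vector_3)
  qed
next
  show "range ad = so3"
  proof
    show "range ad \<subseteq> so3"
      by (auto simp: so3_def ad_def linear_iff cross3_def vec_eq_iff forall_3 inner_vec_def sum_3 algebra_simps)
  next
    show "so3 \<subseteq> range ad"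
    proof
      fix L assume "L \<in> so3"
      then have lin: "linear L" and sk: "\<And>x y. L x \<bullet> y = - (x \<bullet> L y)" by (auto simp: so3_def)
      define e :: "3 \<Rightarrow> real^3" where "e i = axis i 1" for i
      define m where "m i j = L (e j) $ i" for i j
      have skm: "m i j = - m j i" for i j
        using sk[of "e j" "e i"] by (simp add: m_def e_def inner_axis inner_axis')
      have diag: "m i i = 0" for i using skm[of i i] by simp
      have ex: "x = x $ 1 *\<^sub>R e 1 + x $ 2 *\<^sub>R e 2 + x $ 3 *\<^sub>R e 3" for x
        by (simp add: vec_eq_iff forall_3 e_def axis_def)
      have L: "L x $ i = x $ 1 * m i 1 + x $ 2 * m i 2 + x $ 3 * m i 3" for x i
        by (subst ex) (simp add: linear_add[OF lin] linear_scale[OF lin] m_def)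
      have "L = ad (vector [m 3 2, m 1 3, m 2 1])"
        using skm[of 1 2] skm[of 2 3] skm[of 3 1]
        by (auto simp: fun_eq_iff ad_def cross3_def vec_eq_iff forall_3 vector_3 L diag)
      then show "L \<in> range ad" by blast
    qed
  qed
qed

text \<open>Exponential of a linear endomorphism of so(3), as the (pointwise) exponential series.\<close>

definition exp_end :: "(real^3 \<Rightarrow> real^3) \<Rightarrow> real^3 \<Rightarrow> real^3" where
  "exp_end L v = (\<Sum>n. (1 / fact n) *\<^sub>R (L ^^ n) v)"

text \<open>Iterated derivatives relative to \<open>S\<close>; one-sided at the end points of an interval.\<close>

primrec nderiv :: "real set \<Rightarrow> nat \<Rightarrow> (real \<Rightarrow> real^3) \<Rightarrow> real \<Rightarrow> real^3" where
  "nderiv S 0 f = f"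
| "nderiv S (Suc n) f = (\<lambda>t. vector_derivative (nderiv S n f) (at t within S))"

definition smooth_curve :: "real \<Rightarrow> real \<Rightarrow> (real \<Rightarrow> real^3) \<Rightarrow> bool" where
  "smooth_curve t0 t1 U \<longleftrightarrow>
     (\<forall>n. \<forall>t\<in>{t0..t1}. nderiv {t0..t1} n U differentiable (at t within {t0..t1}))"

definition lie_quadratic :: "real \<Rightarrow> real \<Rightarrow> (real \<Rightarrow> real^3) \<Rightarrow> bool" where
  "lie_quadratic t0 t1 U \<longleftrightarrow> smooth_curve t0 t1 U \<and>
     (\<exists>C. \<forall>t\<in>{t0..t1}.
        nderiv {t0..t1} 2 U t = cross3 (nderiv {t0..t1} 1 U t) (U t) + C)"

text \<open>\<open>mixed_deriv t0 t1 V i j h t\<close> is \<open>V\<^sup>(\<^sup>i\<^sup>,\<^sup>j\<^sup>)(h, t)\<close> on the rectangle \<open>[-1, 1] \<times> [t0, t1]\<close>.\<close>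

definition mixed_deriv ::
  "real \<Rightarrow> real \<Rightarrow> (real \<Rightarrow> real \<Rightarrow> real^3) \<Rightarrow> nat \<Rightarrow> nat \<Rightarrow> real \<Rightarrow> real \<Rightarrow> real^3" where
  "mixed_deriv t0 t1 V i j h t =
     nderiv {-1..1} i (\<lambda>s. nderiv {t0..t1} j (V s) t) h"

text \<open>
  \<open>C\<^sup>\<infinity>\<close> on the closed rectangle: partial derivatives of all orders exist, are jointly
  continuous, and do not depend on the order of differentiation.
\<close>

definition smooth_family :: "real \<Rightarrow> real \<Rightarrow> (real \<Rightarrow> real \<Rightarrow> real^3) \<Rightarrow> bool" where
  "smooth_family t0 t1 V \<longleftrightarrow> (\<forall>i j.
     continuous_on ({-1..1} \<times> {t0..t1}) (\<lambda>(h, t). mixed_deriv t0 t1 V i j h t) \<and>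
     (\<forall>h\<in>{-1..1}. \<forall>t\<in>{t0..t1}.
        ((\<lambda>s. mixed_deriv t0 t1 V i j s t) has_vector_derivative
           mixed_deriv t0 t1 V (Suc i) j h t) (at h within {-1..1}) \<and>
        ((\<lambda>s. mixed_deriv t0 t1 V i j h s) has_vector_derivative
           mixed_deriv t0 t1 V i (Suc j) h t) (at t within {t0..t1})))"

definition variation ::
  "real \<Rightarrow> real \<Rightarrow> real^3 \<Rightarrow> (real \<Rightarrow> real \<Rightarrow> real^3) \<Rightarrow> bool" where
  "variation t0 t1 D V \<longleftrightarrow>
     smooth_family t0 t1 V \<and>
     (\<forall>h\<in>{-1..1}. lie_quadratic t0 t1 (V h)) \<and>
     D \<noteq> 0 \<and> (\<forall>t\<in>{t0..t1}. V 0 t = D) \<and>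
     (\<exists>a b. \<forall>h\<in>{-1..1}. V h t0 = a + h *\<^sub>R b) \<and>
     (\<forall>h\<in>{-1..1}. norm (V h t0) \<le> 1)"

definition approx1 ::
  "real \<Rightarrow> real \<Rightarrow> (real \<Rightarrow> real \<Rightarrow> real^3) \<Rightarrow> real \<Rightarrow> real \<Rightarrow> real^3" where
  "approx1 t0 t1 V \<delta> t = V 0 t + \<delta> *\<^sub>R mixed_deriv t0 t1 V 1 0 0 t"

definition e_tilde :: "real \<Rightarrow> real^3 \<Rightarrow> real \<Rightarrow> real^3 \<Rightarrow> real^3" where
  "e_tilde t0 D t = exp_end (\<lambda>v. (- norm D * (t - t0)) *\<^sub>R ad (D /\<^sub>R norm D) v)"

text \<open>
  A Lie quadratic solves a third order equation, so it is determined by its value and its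
  first two derivatives at \<open>t0\<close>. In a \<^const>\<open>variation\<close> only the values \<open>V h t0\<close> are
  normalised; this number measures the dependence on \<open>h\<close> of the other two initial data.
  It is a finite supremum, and at most 1 when these data are also affine in \<open>h\<close> of
  uniform norm at most 1. Without it, no error bound holds with constants independent of
  \<open>V\<close>: take \<open>V h t = D + (k * h\<^sup>2 * (t - t0)) *\<^sub>R D\<close> for large \<open>k\<close>.
\<close>

definition initial_size :: "real \<Rightarrow> real \<Rightarrow> (real \<Rightarrow> real \<Rightarrow> real^3) \<Rightarrow> real" where
  "initial_size t0 t1 V =
     (SUP (i, j, h) \<in> {1, 2} \<times> {1, 2} \<times> {-1..1}. norm (mixed_deriv t0 t1 V i j h t0))"

end

theory Submission
  imports Defs
begin

text \<open>
  For a Lie quadratic \<open>x\<close> with constant \<open>C\<close>, the term \<open>x' \<times> x\<close> in \<open>x'' = x' \<times> x + C\<close> is orthogonal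
  to \<open>x'\<close>, so \<open>|x'|\<close> grows at most at the rate \<open>|C|\<close>; no Gronwall argument is needed. Put
  \<open>u = V\<^sub>\<delta> - D\<close>. The initial data of \<open>u\<close> at \<open>t0\<close> are \<open>O(\<delta>)\<close>, hence so are \<open>u\<close> and \<open>u'\<close> on the
  whole interval. The remainder \<open>r = V\<^sub>\<delta> - V1\<close>, with \<open>V1\<close> the first order approximation, satisfies
  \<open>r'' = r' \<times> D + u' \<times> u + k\<close> for a constant \<open>k\<close>. Taylor's formula in \<open>h\<close>, applied at \<open>t = t0\<close> only,
  makes its initial data and \<open>k\<close> of order \<open>O(\<delta>\<^sup>2)\<close>, so the same growth estimate gives
  \<open>r, r' = O(\<delta>\<^sup>2)\<close>. Higher derivatives follow by differentiating the two equations. The closed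
  form of \<open>V1\<close> comes from solving the linearised equation \<open>w'' = w' \<times> D + C1\<close>; uniqueness is again
  the growth estimate.
\<close>

section \<open>Growth estimates for curves in an inner product space\<close>

text \<open>Where \<open>f\<close> does not vanish, \<open>norm f\<close> has derivative
  \<open>f \<bullet> f' / norm f\<close>, at most \<open>K\<close>. At zeros the norm may fail to be
  differentiable, so the mean value theorem is applied to
  \<open>sqrt (f \<bullet> f + e\<^sup>2)\<close> and \<open>e\<close> is sent to 0.\<close>

lemma norm_le_of_inner_derivative_le:
  fixes f :: "real \<Rightarrow> 'a::real_inner"
  assumes der: "\<And>t. t \<in> {a..b} \<Longrightarrow> (f has_vector_derivative f' t) (at t within {a..b})"
    and le: "\<And>t. t \<in> {a..b} \<Longrightarrow> f t \<bullet> f' t \<le> K * norm (f t)"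
    and K: "0 \<le> K" and t: "t \<in> {a..b}"
  shows "norm (f t) \<le> norm (f a) + K * (t - a)"
proof (rule field_le_epsilon)
  fix e :: real assume e: "0 < e"
  define p where "p s = sqrt (f s \<bullet> f s + e\<^sup>2)" for s
  have pos: "0 < f s \<bullet> f s + e\<^sup>2" for s
    using e by (simp add: add_nonneg_pos)
  have p_ge: "norm (f s) \<le> p s" for s
    unfolding p_def norm_eq_sqrt_inner by simp
  have p_pos: "0 < p s" for s
    unfolding p_def using pos by simp
  have p_le: "p s \<le> norm (f s) + e" for s
    unfolding p_def using sqrt_sum_squares_le_sum[of "norm (f s)" e] e
    by (simp add: power2_norm_eq_inner)
  have sub: "{a..t} \<subseteq> {a..b}" using t by auto
  have "(p has_derivative (\<lambda>h. h * (f s \<bullet> f' s / p s))) (at s within {a..t})"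
    if s: "a \<le> s" "s \<le> t" for s
  proof -
    have "(f has_vector_derivative f' s) (at s within {a..t})"
      using der sub s by (intro has_vector_derivative_within_subset[OF _ sub]) auto
    then have "(f has_derivative (\<lambda>h. h *\<^sub>R f' s)) (at s within {a..t})"
      by (simp add: has_vector_derivative_def)
    then show ?thesis
      unfolding p_def using pos[of s]
      by (auto intro!: derivative_eq_intros simp: inner_commute field_simps)
  qed
  from mvt_very_simple[of a t p, OF _ this] t
  obtain s where s: "s \<in> {a..t}" and eq: "p t - p a = (t - a) * (f s \<bullet> f' s / p s)"
    by auto
  have "f s \<bullet> f' s / p s \<le> K"
    using le[of s] mult_left_mono[OF p_ge[of s] K] p_pos[of s] s sub
    by (simp add: divide_le_eq)
  then have "p t \<le> p a + (t - a) * K"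
    using mult_left_mono[of _ K "t - a"] eq t by fastforce
  then show "norm (f t) \<le> norm (f a) + K * (t - a) + e"
    using p_ge[of t] p_le[of a] by (simp add: mult.commute)
qed

corollary norm_le_of_derivative_le:
  fixes f :: "real \<Rightarrow> 'a::real_inner"
  assumes "\<And>t. t \<in> {a..b} \<Longrightarrow> (f has_vector_derivative f' t) (at t within {a..b})"
    and le: "\<And>t. t \<in> {a..b} \<Longrightarrow> norm (f' t) \<le> K"
    and t: "t \<in> {a..b}"
  shows "norm (f t) \<le> norm (f a) + K * (t - a)"
proof (rule norm_le_of_inner_derivative_le[OF assms(1) _ _ t])
  show "f s \<bullet> f' s \<le> K * norm (f s)" if "s \<in> {a..b}" for s
    using norm_cauchy_schwarz[of "f s" "f' s"] mult_right_mono[OF le[OF that] norm_ge_zero[of "f s"]]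
    by (simp add: mult.commute)
  show "0 \<le> K"
    using le[OF t] norm_ge_zero order_trans by blast
qed

text \<open>The bound on \<open>f2\<close> is integrated twice. Replacing \<open>K * h\<close> by
  \<open>K * x\<close> after the first integration gives the constant \<open>K\<close> instead of
  the sharp \<open>K / 2\<close>.\<close>

lemma norm_taylor_remainder_le:
  fixes f :: "real \<Rightarrow> 'a::real_inner"
  assumes f1: "\<And>h. h \<in> {0..x} \<Longrightarrow> (f has_vector_derivative f1 h) (at h within {0..x})"
    and f2: "\<And>h. h \<in> {0..x} \<Longrightarrow> (f1 has_vector_derivative f2 h) (at h within {0..x})"
    and le: "\<And>h. h \<in> {0..x} \<Longrightarrow> norm (f2 h) \<le> K"
    and x: "0 \<le> x"
  shows "norm (f x - f 0 - x *\<^sub>R f1 0) \<le> K * x\<^sup>2"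
proof -
  have K: "0 \<le> K"
    using le[of 0] x norm_ge_zero order_trans by (metis atLeastAtMost_iff order_refl)
  have 1: "norm (f1 h - f1 0) \<le> K * x" if h: "h \<in> {0..x}" for h
  proof -
    have "norm (f1 h - f1 0) \<le> norm (f1 0 - f1 0) + K * (h - 0)"
      by (rule norm_le_of_derivative_le[where b = x and f' = f2])
         (use le h in \<open>auto intro!: derivative_eq_intros f2\<close>)
    also have "\<dots> \<le> K * x" using K h by (simp add: mult_left_mono)
    finally show ?thesis .
  qed
  have "norm (f x - f 0 - x *\<^sub>R f1 0) \<le> norm (f 0 - f 0 - 0 *\<^sub>R f1 0) + K * x * (x - 0)"
    by (rule norm_le_of_derivative_le[where b = x and f' = "\<lambda>h. f1 h - f1 0"])
       (use 1 x in \<open>auto intro!: derivative_eq_intros f1\<close>)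
  then show ?thesis by (simp add: power2_eq_square mult.assoc)
qed

section \<open>Cross product estimates\<close>

lemma norm_cross3_le: "norm (cross3 x y) \<le> norm x * norm y"
proof (rule power2_le_imp_le)
  show "(norm (cross3 x y))\<^sup>2 \<le> (norm x * norm y)\<^sup>2"
    unfolding norm_cross_dot[symmetric] by simp
qed simp

lemma norm_cross3_mono: "norm x \<le> p \<Longrightarrow> norm y \<le> q \<Longrightarrow> norm (cross3 x y) \<le> p * q"
  by (meson mult_mono' norm_cross3_le norm_ge_zero order_trans)

lemma bounded_bilinear_cross3: "bounded_bilinear cross3"
  by (simp add: bilinear_conv_bounded_bilinear[symmetric] bilinear_cross)

lemmas has_vector_derivative_cross3 =
  bounded_bilinear.has_vector_derivative[OF bounded_bilinear_cross3]

text \<open>The term \<open>cross3 (f t) (g t)\<close> is orthogonal to \<open>f t\<close>, so only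
  \<open>e\<close> contributes to \<open>f \<bullet> f'\<close>. The bound is free of
  \<open>g\<close>, which may therefore be the unknown solution itself.\<close>

lemma norm_le_cross_ode:
  fixes f g e :: "real \<Rightarrow> real^3"
  assumes "\<And>t. t \<in> {a..b} \<Longrightarrow> (f has_vector_derivative cross3 (f t) (g t) + e t) (at t within {a..b})"
    and le: "\<And>t. t \<in> {a..b} \<Longrightarrow> norm (e t) \<le> K"
    and t: "t \<in> {a..b}"
  shows "norm (f t) \<le> norm (f a) + K * (t - a)"
proof (rule norm_le_of_inner_derivative_le[OF assms(1) _ _ t])
  show "f s \<bullet> (cross3 (f s) (g s) + e s) \<le> K * norm (f s)" if "s \<in> {a..b}" for s
    using norm_cauchy_schwarz[of "f s" "e s"] mult_right_mono[OF le[OF that] norm_ge_zero[of "f s"]]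
    by (simp add: mult.commute inner_add_right dot_cross_self)
  show "0 \<le> K"
    using le[OF t] norm_ge_zero order_trans by blast
qed

section \<open>Iterated derivatives on a closed interval and the Leibniz rule\<close>

text \<open>\<open>nderiv\<close> adds each new derivative on the outside. Moving it inside permits
  inductions on the order that replace a curve by its derivative.\<close>

lemma nderiv_Suc_shift: "nderiv S (Suc n) f = nderiv S n (nderiv S 1 f)"
  by (induction n) auto

context
  fixes a b :: real
  assumes less: "a < b"
begin

lemma nderiv_Suc_eqI:
  assumes "(nderiv {a..b} n f has_vector_derivative y) (at t within {a..b})" "t \<in> {a..b}"
  shows "nderiv {a..b} (Suc n) f t = y"
  using vector_derivative_within_closed_interval[OF less assms(2,1)] by simp

lemma smooth_curve_nderiv:
  assumes "smooth_curve a b f" "t \<in> {a..b}"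
  shows "(nderiv {a..b} n f has_vector_derivative nderiv {a..b} (Suc n) f t) (at t within {a..b})"
  using assms unfolding smooth_curve_def by (simp add: vector_derivative_works[symmetric])

lemma has_vector_derivative_cong_Icc:
  assumes "\<And>s. s \<in> {a..b} \<Longrightarrow> f s = g s" "t \<in> {a..b}"
    and "(f has_vector_derivative y) (at t within {a..b})"
  shows "(g has_vector_derivative y) (at t within {a..b})"
  by (rule has_vector_derivative_transform[OF assms(2) _ assms(3)]) (use assms(1) in auto)

text \<open>A sequence of curves, each the derivative of its predecessor, identifies all iterated
  derivatives and yields smoothness at once. The rules for sums, multiples, differences and
  constants exhibit such a sequence.\<close>

lemma smooth_curveI:
  assumes F0: "\<And>t. t \<in> {a..b} \<Longrightarrow> f t = F 0 t"
    and FS: "\<And>n t. t \<in> {a..b} \<Longrightarrow> (F n has_vector_derivative F (Suc n) t) (at t within {a..b})"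
  shows nderiv_eqI: "t \<in> {a..b} \<Longrightarrow> nderiv {a..b} n f t = F n t"
    and "smooth_curve a b f"
proof -
  have eq: "t \<in> {a..b} \<Longrightarrow> nderiv {a..b} n f t = F n t" for n t
  proof (induction n arbitrary: t)
    case (Suc n)
    show ?case
      by (rule nderiv_Suc_eqI[OF has_vector_derivative_cong_Icc[OF _ _ FS]])
         (use Suc in auto)
  qed (use F0 in auto)
  then show "t \<in> {a..b} \<Longrightarrow> nderiv {a..b} n f t = F n t" .
  have "(nderiv {a..b} n f has_vector_derivative F (Suc n) t) (at t within {a..b})"
    if "t \<in> {a..b}" for n t
    by (rule has_vector_derivative_cong_Icc[OF _ that FS]) (use eq that in auto)
  then show "smooth_curve a b f"
    unfolding smooth_curve_def using differentiableI_vector by blast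
qed

lemma smooth_curve_cong:
  assumes "smooth_curve a b g" "\<And>t. t \<in> {a..b} \<Longrightarrow> f t = g t"
  shows nderiv_cong: "t \<in> {a..b} \<Longrightarrow> nderiv {a..b} n f t = nderiv {a..b} n g t"
    and "smooth_curve a b f"
  using smooth_curveI[of f "\<lambda>n. nderiv {a..b} n g"] smooth_curve_nderiv[OF assms(1)] assms(2)
  by auto

lemma smooth_curve_add:
  assumes "smooth_curve a b f" "smooth_curve a b g"
  shows nderiv_add: "t \<in> {a..b} \<Longrightarrow>
      nderiv {a..b} n (\<lambda>s. f s + g s) t = nderiv {a..b} n f t + nderiv {a..b} n g t"
    and "smooth_curve a b (\<lambda>s. f s + g s)"
  using smooth_curveI[of "\<lambda>s. f s + g s" "\<lambda>n s. nderiv {a..b} n f s + nderiv {a..b} n g s"]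
    has_vector_derivative_add[OF smooth_curve_nderiv[OF assms(1)] smooth_curve_nderiv[OF assms(2)]]
  by auto

lemma smooth_curve_scaleR:
  assumes "smooth_curve a b f"
  shows nderiv_scaleR: "t \<in> {a..b} \<Longrightarrow>
      nderiv {a..b} n (\<lambda>s. c *\<^sub>R f s) t = c *\<^sub>R nderiv {a..b} n f t"
    and "smooth_curve a b (\<lambda>s. c *\<^sub>R f s)"
  using smooth_curveI[of "\<lambda>s. c *\<^sub>R f s" "\<lambda>n s. c *\<^sub>R nderiv {a..b} n f s"]
    bounded_linear.has_vector_derivative[OF bounded_linear_scaleR_right smooth_curve_nderiv[OF assms(1)]]
  by auto

lemma smooth_curve_diff:
  assumes "smooth_curve a b f" "smooth_curve a b g"
  shows nderiv_diff: "t \<in> {a..b} \<Longrightarrow>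
      nderiv {a..b} n (\<lambda>s. f s - g s) t = nderiv {a..b} n f t - nderiv {a..b} n g t"
    and "smooth_curve a b (\<lambda>s. f s - g s)"
  using smooth_curveI[of "\<lambda>s. f s - g s" "\<lambda>n s. nderiv {a..b} n f s - nderiv {a..b} n g s"]
    has_vector_derivative_diff[OF smooth_curve_nderiv[OF assms(1)] smooth_curve_nderiv[OF assms(2)]]
  by auto

lemma smooth_curve_const:
  shows nderiv_const: "t \<in> {a..b} \<Longrightarrow> nderiv {a..b} n (\<lambda>s. c) t = (if n = 0 then c else 0)"
    and "smooth_curve a b (\<lambda>s. c)"
  using smooth_curveI[of "\<lambda>s. c" "\<lambda>n s. if n = 0 then c else 0"]
  by auto

lemma smooth_curve_nderiv_1: "smooth_curve a b f \<Longrightarrow> smooth_curve a b (nderiv {a..b} 1 f)"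
  unfolding smooth_curve_def nderiv_Suc_shift[symmetric] by blast

text \<open>Leibniz rule in recursive form: one differentiation is carried out and the other
  \<open>n\<close> stay unexpanded, which avoids binomial sums. Claiming a derivative, not just an
  equation, carries differentiability through the induction; \<open>f\<close> and \<open>g\<close>
  vary because the hypothesis is applied with one factor differentiated.\<close>

lemma nderiv_cross3:
  assumes "t \<in> {a..b}" "smooth_curve a b f" "smooth_curve a b g"
  shows "(nderiv {a..b} n (\<lambda>s. cross3 (f s) (g s)) has_vector_derivative
      nderiv {a..b} n (\<lambda>s. cross3 (f s) (nderiv {a..b} 1 g s)) t +
      nderiv {a..b} n (\<lambda>s. cross3 (nderiv {a..b} 1 f s) (g s)) t) (at t within {a..b})"
  using assms
proof (induction n arbitrary: f g t)
  case 0
  then show ?case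
    using has_vector_derivative_cross3 smooth_curve_nderiv[of f t 0] smooth_curve_nderiv[of g t 0]
    by auto
next
  case (Suc n)
  note IH = Suc.IH and t = Suc.prems(1)
  note sm = Suc.prems(2,3) smooth_curve_nderiv_1[OF Suc.prems(2)] smooth_curve_nderiv_1[OF Suc.prems(3)]
  let ?D = "nderiv {a..b}"
  have "((\<lambda>s. ?D n (\<lambda>s. cross3 (f s) (?D 1 g s)) s + ?D n (\<lambda>s. cross3 (?D 1 f s) (g s)) s)
    has_vector_derivative
      (?D (Suc n) (\<lambda>s. cross3 (f s) (?D 1 g s)) t + ?D (Suc n) (\<lambda>s. cross3 (?D 1 f s) (g s)) t))
      (at t within {a..b})"
    using has_vector_derivative_add[OF IH[OF t sm(1,4)] IH[OF t sm(3,2)]]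
      nderiv_Suc_eqI[OF IH[OF t sm(1,4)] t] nderiv_Suc_eqI[OF IH[OF t sm(3,2)] t] by simp
  then show ?case
    by (rule has_vector_derivative_cong_Icc[OF _ t, rotated])
       (simp add: nderiv_Suc_eqI[OF IH[OF _ sm(1,2)]] del: nderiv.simps)
qed

lemma smooth_curve_cross3:
  assumes "smooth_curve a b f" "smooth_curve a b g"
  shows "smooth_curve a b (\<lambda>s. cross3 (f s) (g s))"
  unfolding smooth_curve_def using nderiv_cross3[OF _ assms] differentiableI_vector by blast

text \<open>Each differentiation doubles the number of products, and each of the resulting
  \<open>2 ^ n\<close> products has norm at most \<open>p * q\<close>.\<close>

lemma norm_nderiv_cross3_le:
  assumes "smooth_curve a b f" "smooth_curve a b g"
    and "\<And>i. i \<le> n \<Longrightarrow> norm (nderiv {a..b} i f t) \<le> p"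
    and "\<And>i. i \<le> n \<Longrightarrow> norm (nderiv {a..b} i g t) \<le> q"
    and t: "t \<in> {a..b}"
  shows "norm (nderiv {a..b} n (\<lambda>s. cross3 (f s) (g s)) t) \<le> 2 ^ n * (p * q)"
  using assms(1-4)
proof (induction n arbitrary: f g)
  case 0
  then show ?case using norm_cross3_mono[of "f t" p "g t" q] by fastforce
next
  case (Suc n)
  let ?D = "nderiv {a..b}"
  note sm = Suc.prems(1,2) smooth_curve_nderiv_1[OF Suc.prems(1)] smooth_curve_nderiv_1[OF Suc.prems(2)]
  have shift: "norm (?D i (?D 1 f) t) \<le> p" "norm (?D i (?D 1 g) t) \<le> q" if "i \<le> n" for i
    using Suc.prems(3)[of "Suc i"] Suc.prems(4)[of "Suc i"] that unfolding nderiv_Suc_shift[symmetric] by auto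
  have "?D (Suc n) (\<lambda>s. cross3 (f s) (g s)) t =
      ?D n (\<lambda>s. cross3 (f s) (?D 1 g s)) t + ?D n (\<lambda>s. cross3 (?D 1 f s) (g s)) t"
    by (rule nderiv_Suc_eqI[OF nderiv_cross3[OF t sm(1,2)] t])
  also have "norm \<dots> \<le> 2 ^ n * (p * q) + 2 ^ n * (p * q)"
    by (intro norm_triangle_mono Suc.IH sm shift) (use Suc.prems in auto)
  finally show ?case by (simp add: mult_ac)
qed

end

text \<open>Differentiating the equation \<open>n\<close> times expresses order \<open>n + 2\<close>
  of \<open>f\<close> through its orders 1 to \<open>n + 1\<close>. This is the induction step for
  higher derivatives, both for \<open>V \<delta>\<close> (with \<open>g\<close> the curve itself)
  and for the remainder (with \<open>g\<close> the constant \<open>D\<close>).\<close>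

lemma norm_nderiv_cross_ode_le:
  fixes a b :: real
  assumes less: "a < b" and f: "smooth_curve a b f" and g: "smooth_curve a b g" and e: "smooth_curve a b e"
    and ode: "\<And>s. s \<in> {a..b} \<Longrightarrow> nderiv {a..b} 2 f s = cross3 (nderiv {a..b} 1 f s) (g s) + e s"
    and t: "t \<in> {a..b}"
    and p: "\<And>i. i \<le> n \<Longrightarrow> norm (nderiv {a..b} (Suc i) f t) \<le> p"
    and q: "\<And>i. i \<le> n \<Longrightarrow> norm (nderiv {a..b} i g t) \<le> q"
    and r: "norm (nderiv {a..b} n e t) \<le> r"
  shows "norm (nderiv {a..b} (Suc (Suc n)) f t) \<le> 2 ^ n * (p * q) + r"
proof -
  note f1 = smooth_curve_nderiv_1[OF less f]
  note fg = smooth_curve_cross3[OF less f1 g]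
  have "nderiv {a..b} (Suc (Suc n)) f = nderiv {a..b} n (nderiv {a..b} 2 f)"
    unfolding nderiv_Suc_shift[of _ "Suc n"] nderiv_Suc_shift[of _ n]
    by (simp add: numeral_2_eq_2)
  then have "nderiv {a..b} (Suc (Suc n)) f t = nderiv {a..b} n (nderiv {a..b} 2 f) t"
    by (rule fun_cong)
  also have "nderiv {a..b} n (nderiv {a..b} 2 f) t
      = nderiv {a..b} n (\<lambda>s. cross3 (nderiv {a..b} 1 f s) (g s) + e s) t"
    by (rule nderiv_cong[OF less smooth_curve_add(2)[OF less fg e] ode t])
  also have "\<dots> = nderiv {a..b} n (\<lambda>s. cross3 (nderiv {a..b} 1 f s) (g s)) t + nderiv {a..b} n e t"
    by (rule nderiv_add[OF less fg e t])
  finally have eq: "nderiv {a..b} (Suc (Suc n)) f t = \<dots>" .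
  have "norm (nderiv {a..b} i (nderiv {a..b} 1 f) t) \<le> p" if "i \<le> n" for i
    using p[OF that] unfolding nderiv_Suc_shift .
  then show ?thesis
    unfolding eq by (intro norm_triangle_mono norm_nderiv_cross3_le[OF less f1 g _ q t] r)
qed

section \<open>Closed form of the linearised equation\<close>

lemma cross3_unit_cross3:
  assumes "norm F = 1"
  shows "cross3 F (cross3 F x) = (F \<bullet> x) *\<^sub>R F - x"
  using assms by (simp add: Lagrange norm_eq_1)

text \<open>On the complement of \<open>F\<close>, \<open>ad F\<close> squares to minus the identity
  and acts like an imaginary unit: even powers feed the cosine series, odd powers the sine
  series.\<close>

lemma exp_end_rotation:
  assumes F: "norm F = 1" and B: "F \<bullet> B = 0"
  shows "exp_end (\<lambda>v. c *\<^sub>R ad F v) B = cos c *\<^sub>R B + sin c *\<^sub>R cross3 F B"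
proof -
  let ?L = "\<lambda>v. c *\<^sub>R ad F v"
  have pow: "(?L ^^ n) B = (fact n * (cos_coeff n * c ^ n)) *\<^sub>R B
      + (fact n * (sin_coeff n * c ^ n)) *\<^sub>R cross3 F B" for n
  proof (induction n)
    case (Suc n)
    have eq: "fact (Suc n) * (sin_coeff (Suc n) * c ^ Suc n) = c * (fact n * (cos_coeff n * c ^ n))"
      "fact (Suc n) * (cos_coeff (Suc n) * c ^ Suc n) = - (c * (fact n * (sin_coeff n * c ^ n)))"
      by (simp_all add: sin_coeff_Suc cos_coeff_Suc del: of_nat_Suc)
    have "(?L ^^ Suc n) B = c *\<^sub>R cross3 F ((?L ^^ n) B)"
      by (simp add: ad_def)
    also have "\<dots> = - (c * (fact n * (sin_coeff n * c ^ n))) *\<^sub>R B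
        + (c * (fact n * (cos_coeff n * c ^ n))) *\<^sub>R cross3 F B"
      unfolding Suc by (simp add: cross_add_right cross_mult_right cross3_unit_cross3[OF F] B
          scaleR_diff_right)
    finally show ?case unfolding eq .
  qed simp
  have "(\<lambda>n. (cos_coeff n *\<^sub>R c ^ n) *\<^sub>R B + (sin_coeff n *\<^sub>R c ^ n) *\<^sub>R cross3 F B)
      sums (cos c *\<^sub>R B + sin c *\<^sub>R cross3 F B)"
    by (intro sums_add sums_scaleR_left cos_converges sin_converges)
  then show ?thesis
    unfolding exp_end_def using pow by (simp add: sums_iff scaleR_add_right)
qed

text \<open>An explicit solution \<open>y\<close> with the initial data of \<open>w\<close> is
  written down, and uniqueness identifies the two. Along \<open>D\<close> the cross product
  vanishes, which leaves a quadratic polynomial; orthogonally to \<open>D\<close> it produces the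
  rotation.\<close>

lemma linear_ode_closed_form:
  fixes w w' :: "real \<Rightarrow> real^3"
  assumes w: "\<And>t. t \<in> {a..b} \<Longrightarrow> (w has_vector_derivative w' t) (at t within {a..b})"
    and w': "\<And>t. t \<in> {a..b} \<Longrightarrow>
      (w' has_vector_derivative cross3 (w' t) D + C) (at t within {a..b})"
    and D: "D \<noteq> 0"
  shows "\<exists>c0 c1 c2. \<exists>A0 \<in> orthogonal_comp {D /\<^sub>R norm D}. \<exists>A1 \<in> orthogonal_comp {D /\<^sub>R norm D}.
    \<exists>B \<in> orthogonal_comp {D /\<^sub>R norm D}. \<forall>t\<in>{a..b}.
      w t = (c0 + c1 * (t - a) + c2 * (t - a)\<^sup>2) *\<^sub>R (D /\<^sub>R norm D)
        + A0 + (t - a) *\<^sub>R A1 + e_tilde a D t B"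
proof -
  define d where "d = norm D"
  define F where "F = D /\<^sub>R d"
  have d: "d > 0" using D by (simp add: d_def)
  have F: "norm F = 1" using d by (simp add: F_def d_def)
  then have FF: "F \<bullet> F = 1" by (simp add: norm_eq_1)
  have DF: "D = d *\<^sub>R F" using d by (simp add: F_def)
  \<comment> \<open>The constants come from the ansatz \<open>y\<close> below. \<open>c0\<close>,
    \<open>c1\<close>, \<open>c2\<close> match the components along \<open>F\<close> of
    \<open>w a\<close>, \<open>w' a\<close> and the equation. \<open>A1\<close> balances the part of
    \<open>C\<close> orthogonal to \<open>F\<close>; then \<open>w' a\<close> forces
    \<open>B\<close>, and \<open>w a\<close> forces \<open>A0\<close>.\<close>
  define c0 c1 c2 where "c0 = F \<bullet> w a" and "c1 = F \<bullet> w' a" and "c2 = F \<bullet> C / 2"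
  define A1 where "A1 = (- 1 / d) *\<^sub>R cross3 F C"
  define B where "B = (1 / d) *\<^sub>R cross3 F (w' a - A1)"
  define A0 where "A0 = w a - c0 *\<^sub>R F - B"
  define G where "G = cross3 F B"
  have A1_perp: "F \<bullet> A1 = 0" and B_perp: "F \<bullet> B = 0"
    by (simp_all add: A1_def B_def dot_cross_self)
  have A0_perp: "F \<bullet> A0 = 0"
    by (simp add: A0_def inner_diff_right B_perp FF c0_def)
  have FG: "cross3 F G = - B"
    using cross3_unit_cross3[OF F] by (simp add: G_def B_perp)
  have FA1: "d *\<^sub>R cross3 F A1 = C - (2 * c2) *\<^sub>R F"
    using d by (simp add: A1_def cross_mult_right cross3_unit_cross3[OF F] c2_def)
  have dG: "d *\<^sub>R G = c1 *\<^sub>R F + A1 - w' a"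
    using d by (simp add: G_def B_def cross_mult_right cross3_unit_cross3[OF F] c1_def
        inner_diff_right A1_perp)
  define y where "y t = (c0 + c1 * (t - a) + c2 * (t - a)\<^sup>2) *\<^sub>R F + A0 + (t - a) *\<^sub>R A1
    + cos (d * (t - a)) *\<^sub>R B - sin (d * (t - a)) *\<^sub>R G" for t
  define y' where "y' t = (c1 + 2 * c2 * (t - a)) *\<^sub>R F + A1
    - (d * sin (d * (t - a))) *\<^sub>R B - (d * cos (d * (t - a))) *\<^sub>R G" for t
  have y: "(y has_vector_derivative y' t) (at t within {a..b})" for t
    unfolding y_def y'_def
    by (auto intro!: derivative_eq_intros simp: has_real_derivative_iff_has_vector_derivative[symmetric] algebra_simps)
  have y'_ode: "(2 * c2) *\<^sub>R F - (d\<^sup>2 * cos (d * (t - a))) *\<^sub>R B + (d\<^sup>2 * sin (d * (t - a))) *\<^sub>R G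
      = cross3 (y' t) D + C" for t
  proof -
    have "cross3 (y' t) D = - (d *\<^sub>R cross3 F (y' t))"
      unfolding DF using cross_skew[of "y' t" F] by (simp add: cross_mult_right)
    also have "cross3 F (y' t) = cross3 F A1 - (d * sin (d * (t - a))) *\<^sub>R G + (d * cos (d * (t - a))) *\<^sub>R B"
      by (simp add: y'_def cross_add_right Cross3.right_diff_distrib cross_mult_right FG
          flip: G_def)
    also have "- (d *\<^sub>R \<dots>) = - (d *\<^sub>R cross3 F A1) + (d\<^sup>2 * sin (d * (t - a))) *\<^sub>R G
        - (d\<^sup>2 * cos (d * (t - a))) *\<^sub>R B"
      by (simp add: algebra_simps power2_eq_square)
    finally show ?thesis by (simp add: FA1)
  qed
  have y': "(y' has_vector_derivative cross3 (y' t) D + C) (at t within {a..b})" for t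
    unfolding y'_ode[symmetric] unfolding y'_def
    by (auto intro!: derivative_eq_intros simp: has_real_derivative_iff_has_vector_derivative[symmetric]
        algebra_simps power2_eq_square)
  have "y' a = w' a" using dG by (simp add: y'_def algebra_simps)
  have diff_ode: "((\<lambda>t. w' t - y' t) has_vector_derivative cross3 (w' t - y' t) D + 0) (at t within {a..b})"
    if "t \<in> {a..b}" for t
    using has_vector_derivative_diff[OF w'[OF that] y'[of t]]
    by (simp add: Cross3.left_diff_distrib)
  \<comment> \<open>Uniqueness is the growth estimate with \<open>K = 0\<close>, first for the
    derivatives and then for the curves.\<close>
  have w'_eq: "w' t = y' t" if "t \<in> {a..b}" for t
    using norm_le_cross_ode[where K = 0, OF diff_ode _ that] \<open>y' a = w' a\<close> by simp
  have "w t = y t" if t: "t \<in> {a..b}" for t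
    using norm_le_of_derivative_le[where K = 0 and f = "\<lambda>t. w t - y t",
        OF has_vector_derivative_diff[OF w y] _ t] w'_eq
    by (simp add: y_def A0_def)
  \<comment> \<open>The minus sign before the sine comes from the factor \<open>- norm D\<close> in
    the exponent of \<open>e_tilde\<close>.\<close>
  moreover have "e_tilde a D t B = cos (d * (t - a)) *\<^sub>R B - sin (d * (t - a)) *\<^sub>R G" for t
    unfolding e_tilde_def d_def[symmetric] F_def[symmetric] G_def
    by (subst exp_end_rotation[OF F B_perp]) simp
  ultimately have "\<forall>t\<in>{a..b}. w t = (c0 + c1 * (t - a) + c2 * (t - a)\<^sup>2) *\<^sub>R F
        + A0 + (t - a) *\<^sub>R A1 + e_tilde a D t B"
    by (simp add: y_def)
  moreover have "A0 \<in> orthogonal_comp {F}" "A1 \<in> orthogonal_comp {F}" "B \<in> orthogonal_comp {F}"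
    using A0_perp A1_perp B_perp by (simp_all add: orthogonal_comp_def orthogonal_def)
  ultimately show ?thesis
    unfolding d_def[symmetric] F_def[symmetric] by blast
qed

section \<open>Explicit constants and their monotonicity\<close>

text \<open>
  With \<open>T = t1 - t0\<close> and \<open>s\<close> the size of the initial data, step \<open>0\<close> comes from the growth
  estimate and bounds the derivatives of order \<open>0\<close> and \<open>1\<close>; step \<open>n\<close> bounds those up to order
  \<open>n + 1\<close>. The factor \<open>2\<^sup>n\<close> is the Leibniz rule for the \<open>n\<close>-th derivative of a cross product.
\<close>

primrec deviation_bound :: "real \<Rightarrow> real \<Rightarrow> nat \<Rightarrow> real" where
  "deviation_bound T s 0 = (1 + T) * (1 + 2 * s * (1 + T))"
| "deviation_bound T s (Suc n) = deviation_bound T s n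
    + 2 ^ n * (deviation_bound T s n * (1 + deviation_bound T s n))"

primrec remainder_bound :: "real \<Rightarrow> real \<Rightarrow> nat \<Rightarrow> real" where
  "remainder_bound T s 0 = (1 + T) * (4 * s + T * ((deviation_bound T s 0)\<^sup>2 + 3 * s))"
| "remainder_bound T s (Suc n) = remainder_bound T s n
    + 2 ^ n * (remainder_bound T s n + (deviation_bound T s n)\<^sup>2)"

lemma deviation_bound_nonneg: "0 \<le> T \<Longrightarrow> 0 \<le> s \<Longrightarrow> 0 \<le> deviation_bound T s n"
  by (induction n) auto

lemma remainder_bound_nonneg: "0 \<le> T \<Longrightarrow> 0 \<le> s \<Longrightarrow> 0 \<le> remainder_bound T s n"
  by (induction n) auto

text \<open>The constant term of the equation is compared with the bound of step 0 only; this
  carries the comparison to every step.\<close>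

lemma deviation_bound_ge_0:
  "0 \<le> T \<Longrightarrow> 0 \<le> s \<Longrightarrow> deviation_bound T s 0 \<le> deviation_bound T s n"
proof (induction n)
  case (Suc n)
  then show ?case
    using deviation_bound_nonneg[of T s n] by (auto intro: order_trans simp del: deviation_bound.simps(1))
qed simp

lemma deviation_bound_mono:
  "0 \<le> T \<Longrightarrow> 0 \<le> s \<Longrightarrow> s \<le> s' \<Longrightarrow> deviation_bound T s n \<le> deviation_bound T s' n"
proof (induction n)
  case 0
  then show ?case by (auto intro!: mult_left_mono mult_right_mono)
next
  case (Suc n)
  then show ?case
    using deviation_bound_nonneg[of T s n] 
    by (auto intro!: add_mono mult_left_mono mult_mono)
qed

lemma remainder_bound_ge_0:
  "0 \<le> T \<Longrightarrow> 0 \<le> s \<Longrightarrow> remainder_bound T s 0 \<le> remainder_bound T s n"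
proof (induction n)
  case (Suc n)
  then show ?case
    using remainder_bound_nonneg[of T s n] by (auto intro: order_trans simp del: remainder_bound.simps(1))
qed simp

text \<open>Source of the monotonicity in the initial size that the theorem asserts for its
  constants.\<close>

lemma remainder_bound_mono:
  assumes "0 \<le> T" "0 \<le> s" "s \<le> s'"
  shows "remainder_bound T s n \<le> remainder_bound T s' n"
proof (induction n)
  have sq: "(deviation_bound T s n)\<^sup>2 \<le> (deviation_bound T s' n)\<^sup>2" for n
    using deviation_bound_mono deviation_bound_nonneg assms by (intro power_mono) auto
  case 0
  then show ?case
    using sq[of 0] assms 
    by (auto simp del: deviation_bound.simps intro!: mult_left_mono add_mono)
  case (Suc n)
  then show ?case
    using sq[of n] by (auto intro!: add_mono mult_left_mono)
qed

section \<open>Variations: initial data and linearisation\<close>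

context
  fixes t0 t1 :: real and D :: "real^3" and V :: "real \<Rightarrow> real \<Rightarrow> real^3"
  assumes less: "t0 < t1" and var: "variation t0 t1 D V"
begin

lemma mixed_deriv_0 [simp]: "mixed_deriv t0 t1 V 0 j h t = nderiv {t0..t1} j (V h) t"
  by (simp add: mixed_deriv_def)

lemma has_vector_derivative_mixed:
  assumes "h \<in> {-1..1}" "t \<in> {t0..t1}"
  shows mixed_deriv_dh: "((\<lambda>s. mixed_deriv t0 t1 V i j s t) has_vector_derivative
           mixed_deriv t0 t1 V (Suc i) j h t) (at h within {-1..1})"
    and mixed_deriv_dt: "((\<lambda>s. mixed_deriv t0 t1 V i j h s) has_vector_derivative
           mixed_deriv t0 t1 V i (Suc j) h t) (at t within {t0..t1})"
  using var assms unfolding variation_def smooth_family_def by blast+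

lemma smooth_curve_variation: "h \<in> {-1..1} \<Longrightarrow> smooth_curve t0 t1 (V h)"
  using var unfolding variation_def lie_quadratic_def by blast

lemma smooth_curve_mixed_deriv:
  assumes "h \<in> {-1..1}"
  shows nderiv_mixed_deriv: "t \<in> {t0..t1} \<Longrightarrow>
      nderiv {t0..t1} j (mixed_deriv t0 t1 V i 0 h) t = mixed_deriv t0 t1 V i j h t"
    and "smooth_curve t0 t1 (mixed_deriv t0 t1 V i 0 h)"
  using smooth_curveI[OF less, of "mixed_deriv t0 t1 V i 0 h" "\<lambda>j. mixed_deriv t0 t1 V i j h"]
    mixed_deriv_dt[OF assms]
  by auto

lemma variation_0:
  assumes "t \<in> {t0..t1}"
  shows "nderiv {t0..t1} j (V 0) t = (if j = 0 then D else 0)"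
proof -
  have "nderiv {t0..t1} j (V 0) t = nderiv {t0..t1} j (\<lambda>s. D) t"
    using var assms unfolding variation_def
    by (intro nderiv_cong[OF less smooth_curve_const(2)[OF less]]) auto
  then show ?thesis using nderiv_const[OF less assms] by simp
qed

text \<open>The constant of a Lie quadratic may vary with \<open>h\<close>. Evaluating the equation
  at \<open>t0\<close> expresses it through the initial data, for which estimates are
  available.\<close>

lemma variation_quadratic:
  assumes "h \<in> {-1..1}" "t \<in> {t0..t1}"
  shows "nderiv {t0..t1} 2 (V h) t = cross3 (nderiv {t0..t1} 1 (V h) t) (V h t)
    + (nderiv {t0..t1} 2 (V h) t0 - cross3 (nderiv {t0..t1} 1 (V h) t0) (V h t0))"
proof -
  obtain C where "\<forall>t\<in>{t0..t1}. nderiv {t0..t1} 2 (V h) t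
      = cross3 (nderiv {t0..t1} 1 (V h) t) (V h t) + C"
    using var assms(1) unfolding variation_def lie_quadratic_def by blast
  from bspec[OF this assms(2)] bspec[OF this, of t0] less show ?thesis by simp
qed

text \<open>For each \<open>h\<close>, \<open>x'' - x' \<times> x\<close> with
  \<open>x = V h\<close> is constant in time, hence so is its derivative in \<open>h\<close> at 0.
  Since \<open>V 0\<close> is the constant \<open>D\<close>, the product rule leaves only the term
  with \<open>D\<close>.\<close>

lemma linearised_quadratic:
  assumes t: "t \<in> {t0..t1}"
  shows "mixed_deriv t0 t1 V 1 2 0 t = cross3 (mixed_deriv t0 t1 V 1 1 0 t) D
    + (mixed_deriv t0 t1 V 1 2 0 t0 - cross3 (mixed_deriv t0 t1 V 1 1 0 t0) D)"
proof -
  define Q where "Q h s = nderiv {t0..t1} 2 (V h) s - cross3 (nderiv {t0..t1} 1 (V h) s) (V h s)" for h s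
  define Q' where "Q' s = mixed_deriv t0 t1 V 1 2 0 s - cross3 (mixed_deriv t0 t1 V 1 1 0 s) D" for s
  have Q': "((\<lambda>h. Q h s) has_vector_derivative Q' s) (at 0 within {-1..1})" if s: "s \<in> {t0..t1}" for s
  proof -
    have d: "((\<lambda>h. nderiv {t0..t1} j (V h) s) has_vector_derivative mixed_deriv t0 t1 V 1 j 0 s)
        (at 0 within {-1..1})" for j
      using mixed_deriv_dh[of 0 s 0 j] s by simp
    show ?thesis
      unfolding Q_def Q'_def
      using has_vector_derivative_diff[OF d[of 2] has_vector_derivative_cross3[OF d[of 1] d[of 0]]]
        variation_0[OF s, of 1] variation_0[OF s, of 0]
      by simp
  qed
  \<comment> \<open>As \<open>Q h t = Q h t0\<close> for all \<open>h\<close>, the vectors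
    \<open>Q' t\<close> and \<open>Q' t0\<close> are derivatives of the same function of
    \<open>h\<close>.\<close>
  have t0: "t0 \<in> {t0..t1}" using less by simp
  have "((\<lambda>h. Q h t) has_vector_derivative Q' t0) (at 0 within {-1..1})"
    by (rule has_vector_derivative_transform[OF _ _ Q'[OF t0]])
      (use variation_quadratic[OF _ t] in \<open>auto simp: Q_def\<close>)
  with Q'[OF t] have "Q' t = Q' t0"
    using vector_derivative_unique_within_closed_interval[of "-1" 1 0] by fastforce
  then show ?thesis by (simp add: Q'_def algebra_simps)
qed

lemma variation_initial:
  shows variation_initial_affine: "h \<in> {-1..1} \<Longrightarrow> V h t0 = D + h *\<^sub>R mixed_deriv t0 t1 V 1 0 0 t0"
    and norm_variation_initial: "h \<in> {-1..1} \<Longrightarrow> norm (V h t0) \<le> 1"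
    and norm_variation_slope: "norm (mixed_deriv t0 t1 V 1 0 0 t0) \<le> 1"
    and norm_constant: "norm D \<le> 1"
proof -
  obtain p q where pq: "\<And>h. h \<in> {-1..1} \<Longrightarrow> V h t0 = p + h *\<^sub>R q"
    and le: "\<And>h. h \<in> {-1..1} \<Longrightarrow> norm (V h t0) \<le> 1"
    using var unfolding variation_def by blast
  have t0: "t0 \<in> {t0..t1}" using less by simp
  have p: "p = D" using pq[of 0] variation_0[OF t0, of 0] by simp
  have "((\<lambda>h. V h t0) has_vector_derivative q) (at 0 within {-1..1})"
    by (rule has_vector_derivative_transform[of _ _ _ "\<lambda>h. p + h *\<^sub>R q"])
      (auto simp: pq intro!: derivative_eq_intros)
  with mixed_deriv_dh[of 0 t0 0 0] t0 have q: "mixed_deriv t0 t1 V 1 0 0 t0 = q"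
    using vector_derivative_unique_within_closed_interval[of "-1" 1 0] by fastforce
  show "h \<in> {-1..1} \<Longrightarrow> V h t0 = D + h *\<^sub>R mixed_deriv t0 t1 V 1 0 0 t0"
    using pq p q by simp
  show "h \<in> {-1..1} \<Longrightarrow> norm (V h t0) \<le> 1" by (rule le)
  show "norm D \<le> 1" using le[of 0] pq[of 0] p by simp
  \<comment> \<open>\<open>2 *\<^sub>R q\<close> is the difference of the values at
    \<open>h = 1\<close> and \<open>h = -1\<close>, each of norm at most 1.\<close>
  have "norm (2 *\<^sub>R q) \<le> norm (V 1 t0) + norm (V (- 1) t0)"
    using norm_triangle_ineq4[of "V 1 t0" "V (- 1) t0"] by (simp add: pq scaleR_2 algebra_simps)
  also have "\<dots> \<le> 1 + 1" by (intro add_mono le) auto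
  finally show "norm (mixed_deriv t0 t1 V 1 0 0 t0) \<le> 1" unfolding q by simp
qed

text \<open>A real supremum bounds its members only when the set is bounded above. This follows from
  continuity in \<open>h\<close> on the compact interval and the finite choice of \<open>i\<close>
  and \<open>j\<close>.\<close>

lemma norm_mixed_deriv_le_initial_size:
  assumes "i \<in> {1, 2}" "j \<in> {1, 2}" "h \<in> {-1..1}"
  shows "norm (mixed_deriv t0 t1 V i j h t0) \<le> initial_size t0 t1 V"
proof -
  have t0: "t0 \<in> {t0..t1}" using less by simp
  have "bdd_above ((\<lambda>h. norm (mixed_deriv t0 t1 V i j h t0)) ` {-1..1})" for i j
  proof (intro bounded_imp_bdd_above compact_imp_bounded compact_continuous_image continuous_on_norm)
    show "continuous_on {-1..1} (\<lambda>h. mixed_deriv t0 t1 V i j h t0)"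
      unfolding continuous_on_eq_continuous_within
      using mixed_deriv_dh[OF _ t0] has_vector_derivative_continuous by blast
  qed simp
  then have bdd_UN: "bdd_above (\<Union>i\<in>{1,2}. \<Union>j\<in>{1,2}. (\<lambda>h. norm (mixed_deriv t0 t1 V i j h t0)) ` {-1..1})"
    by (intro bdd_above_UN[THEN iffD2]) auto
  have "(\<lambda>(i, j, h). norm (mixed_deriv t0 t1 V i j h t0)) ` (I \<times> J \<times> H)
      \<subseteq> (\<Union>i\<in>I. \<Union>j\<in>J. (\<lambda>h. norm (mixed_deriv t0 t1 V i j h t0)) ` H)" for I J H
    by auto
  then have bdd: "bdd_above ((\<lambda>(i, j, h). norm (mixed_deriv t0 t1 V i j h t0)) ` ({1, 2} \<times> {1, 2} \<times> {-1..1}))"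
    by (rule bdd_above_mono[OF bdd_UN])
  show ?thesis
    unfolding initial_size_def
    by (rule cSUP_upper2[where x = "(i, j, h)", OF bdd]) (use assms in auto)
qed

lemma initial_size_nonneg: "0 \<le> initial_size t0 t1 V"
  by (rule order_trans[OF norm_ge_zero norm_mixed_deriv_le_initial_size[of 1 1 0]]) auto

text \<open>\<open>V 0\<close> is constant, so its time derivatives of orders 1 and 2 vanish. The
  two bounds expand in \<open>h\<close> on \<open>{0..\<delta>}\<close>, with
  \<open>initial_size\<close> controlling the first and the second derivative in \<open>h\<close>
  respectively.\<close>

lemma norm_initial_deriv_le:
  assumes j: "j \<in> {1, 2}" and \<delta>: "\<delta> \<in> {0<..<1}"
  shows "norm (nderiv {t0..t1} j (V \<delta>) t0) \<le> initial_size t0 t1 V * \<delta>"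
    and "norm (nderiv {t0..t1} j (V \<delta>) t0 - \<delta> *\<^sub>R mixed_deriv t0 t1 V 1 j 0 t0)
      \<le> initial_size t0 t1 V * \<delta>\<^sup>2"
proof -
  have t0: "t0 \<in> {t0..t1}" using less by simp
  have sub: "{0..\<delta>} \<subseteq> {-1..1}" using \<delta> by auto
  have d: "((\<lambda>h. mixed_deriv t0 t1 V i j h t0) has_vector_derivative
      mixed_deriv t0 t1 V (Suc i) j h t0) (at h within {0..\<delta>})" if "h \<in> {0..\<delta>}" for i h
    using that sub t0 by (intro has_vector_derivative_within_subset[OF mixed_deriv_dh sub]) auto
  have z: "nderiv {t0..t1} j (V 0) t0 = 0"
    using variation_0[OF t0, of j] j by auto
  have le: "norm (mixed_deriv t0 t1 V i j h t0) \<le> initial_size t0 t1 V"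
    if "h \<in> {0..\<delta>}" "i \<in> {1, 2}" for i h
    by (rule norm_mixed_deriv_le_initial_size) (use that sub j in auto)
  show "norm (nderiv {t0..t1} j (V \<delta>) t0) \<le> initial_size t0 t1 V * \<delta>"
    using norm_le_of_derivative_le[where K = "initial_size t0 t1 V" and t = \<delta>, OF d[of _ 0] le] \<delta> z
    by simp
  show "norm (nderiv {t0..t1} j (V \<delta>) t0 - \<delta> *\<^sub>R mixed_deriv t0 t1 V 1 j 0 t0)
      \<le> initial_size t0 t1 V * \<delta>\<^sup>2"
    using norm_taylor_remainder_le[OF d[of _ 0] d[of _ "Suc 0"] le] \<delta> z
    by (simp add: numeral_2_eq_2)
qed

lemma smooth_curve_approx1:
  shows nderiv_approx1: "t \<in> {t0..t1} \<Longrightarrow> nderiv {t0..t1} j (approx1 t0 t1 V \<delta>) t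
      = (if j = 0 then D else 0) + \<delta> *\<^sub>R mixed_deriv t0 t1 V 1 j 0 t"
    and "smooth_curve t0 t1 (approx1 t0 t1 V \<delta>)"
proof -
  note V0 = smooth_curve_variation[of 0, simplified]
  note w = smooth_curve_mixed_deriv(2)[of 0 1, simplified]
  note dw = smooth_curve_scaleR(2)[OF less w, of \<delta>]
  have eq: "approx1 t0 t1 V \<delta> = (\<lambda>t. V 0 t + \<delta> *\<^sub>R mixed_deriv t0 t1 V (Suc 0) 0 0 t)"
    by (simp add: approx1_def fun_eq_iff)
  show "smooth_curve t0 t1 (approx1 t0 t1 V \<delta>)"
    unfolding eq by (rule smooth_curve_add(2)[OF less V0 dw])
  show "t \<in> {t0..t1} \<Longrightarrow> nderiv {t0..t1} j (approx1 t0 t1 V \<delta>) t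
      = (if j = 0 then D else 0) + \<delta> *\<^sub>R mixed_deriv t0 t1 V 1 j 0 t"
    unfolding eq
    using nderiv_add[OF less V0 dw] nderiv_scaleR[OF less w] variation_0
      nderiv_mixed_deriv[of 0 t j 1]
    by simp
qed

text \<open>The closed form is that of \<open>mixed_deriv t0 t1 V 1 0 0\<close>, so the coefficients
  are chosen before \<delta> and serve every \<delta>.\<close>

lemma approx1_closed_form:
  "\<exists>c0 c1 c2. \<exists>A0 \<in> orthogonal_comp {D /\<^sub>R norm D}. \<exists>A1 \<in> orthogonal_comp {D /\<^sub>R norm D}.
    \<exists>B \<in> orthogonal_comp {D /\<^sub>R norm D}. \<forall>\<delta>. \<forall>t\<in>{t0..t1}.
      approx1 t0 t1 V \<delta> t = D + \<delta> *\<^sub>R ((c0 + c1 * (t - t0) + c2 * (t - t0)\<^sup>2) *\<^sub>R (D /\<^sub>R norm D)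
        + A0 + (t - t0) *\<^sub>R A1 + e_tilde t0 D t B)"
proof -
  have "((mixed_deriv t0 t1 V 1 1 0) has_vector_derivative
      cross3 (mixed_deriv t0 t1 V 1 1 0 t) D
      + (mixed_deriv t0 t1 V 1 2 0 t0 - cross3 (mixed_deriv t0 t1 V 1 1 0 t0) D)) (at t within {t0..t1})"
    if "t \<in> {t0..t1}" for t
    using mixed_deriv_dt[of 0 t 1 1] linearised_quadratic[OF that] that
    by (simp add: numeral_2_eq_2)
  moreover have "((mixed_deriv t0 t1 V 1 0 0) has_vector_derivative mixed_deriv t0 t1 V 1 1 0 t)
      (at t within {t0..t1})" if "t \<in> {t0..t1}" for t
    using mixed_deriv_dt[of 0 t 1 0] that by simp
  moreover have "D \<noteq> 0" using var by (simp add: variation_def)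
  moreover have "V 0 t = D" if "t \<in> {t0..t1}" for t
    using variation_0[OF that, of 0] by simp
  ultimately obtain c0 c1 c2 A0 A1 B where form:
    "A0 \<in> orthogonal_comp {D /\<^sub>R norm D}" "A1 \<in> orthogonal_comp {D /\<^sub>R norm D}"
    "B \<in> orthogonal_comp {D /\<^sub>R norm D}"
    "\<forall>t\<in>{t0..t1}. mixed_deriv t0 t1 V 1 0 0 t
      = (c0 + c1 * (t - t0) + c2 * (t - t0)\<^sup>2) *\<^sub>R (D /\<^sub>R norm D)
        + A0 + (t - t0) *\<^sub>R A1 + e_tilde t0 D t B"
    "\<forall>t\<in>{t0..t1}. V 0 t = D"
    using linear_ode_closed_form[of t0 t1 "mixed_deriv t0 t1 V 1 0 0" "mixed_deriv t0 t1 V 1 1 0" D]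
    by metis
  show ?thesis
    unfolding approx1_def
    by (rule exI[of _ c0], rule exI[of _ c1], rule exI[of _ c2],
        rule bexI[of _ A0], rule bexI[of _ A1], rule bexI[of _ B]) (use form in auto)
qed

section \<open>Deviation and remainder at a fixed \<delta>\<close>

context
  fixes \<delta> :: real
  assumes \<delta>: "\<delta> \<in> {0<..<1}"
begin

lemma smooth_curve_deviation:
  shows nderiv_deviation: "t \<in> {t0..t1} \<Longrightarrow>
      nderiv {t0..t1} j (\<lambda>t. V \<delta> t - D) t = nderiv {t0..t1} j (V \<delta>) t - (if j = 0 then D else 0)"
    and "smooth_curve t0 t1 (\<lambda>t. V \<delta> t - D)"
proof -
  have x: "smooth_curve t0 t1 (V \<delta>)"
    using \<delta> by (intro smooth_curve_variation) auto
  note D = smooth_curve_const(2)[OF less, of D]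
  show "smooth_curve t0 t1 (\<lambda>t. V \<delta> t - D)"
    by (rule smooth_curve_diff(2)[OF less x D])
  show "t \<in> {t0..t1} \<Longrightarrow>
      nderiv {t0..t1} j (\<lambda>t. V \<delta> t - D) t = nderiv {t0..t1} j (V \<delta>) t - (if j = 0 then D else 0)"
    using nderiv_diff[OF less x D] nderiv_const[OF less] by simp
qed

text \<open>The order runs up to \<open>Suc n\<close> because step 0 controls the deviation and its
  first derivative together; each further differentiation of the equation adds one order.\<close>

lemma norm_deviation_le:
  "i \<le> Suc n \<Longrightarrow> t \<in> {t0..t1} \<Longrightarrow> norm (nderiv {t0..t1} i (\<lambda>t. V \<delta> t - D) t)
     \<le> \<delta> * deviation_bound (t1 - t0) (initial_size t0 t1 V) n"
proof -
  define s T where "s = initial_size t0 t1 V" and "T = t1 - t0"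
  let ?x = "V \<delta>" and ?u = "\<lambda>t. V \<delta> t - D" and ?D = "nderiv {t0..t1}" and ?U = "deviation_bound T s"
  define C where "C = ?D 2 ?x t0 - cross3 (?D 1 ?x t0) (?x t0)"
  have s: "0 \<le> s" and T: "0 \<le> T"
    using initial_size_nonneg less by (simp_all add: s_def T_def)
  have \<delta>': "0 \<le> \<delta>" "\<delta> \<le> 1" "\<delta> \<in> {-1..1}" using \<delta> by auto
  have t0: "t0 \<in> {t0..t1}" using less by simp
  note x = smooth_curve_variation[OF \<delta>'(3)]
  have du: "?D (Suc i) ?u t = ?D (Suc i) ?x t" if "t \<in> {t0..t1}" for i t
    using nderiv_deviation[OF that, of "Suc i"] by simp
  have init: "norm (?D 1 ?x t0) \<le> s * \<delta>" "norm (?D 2 ?x t0) \<le> s * \<delta>"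
    using norm_initial_deriv_le(1)[OF _ \<delta>] by (auto simp: s_def simp del: nderiv.simps)
  \<comment> \<open>The factor 1 bounds \<open>V \<delta> t0\<close>; the other factors are initial
    derivatives of order \<delta>.\<close>
  have "norm C \<le> s * \<delta> + s * \<delta> * 1"
    unfolding C_def using norm_triangle_ineq4 norm_cross3_mono init norm_variation_initial[OF \<delta>'(3)]
    by (meson add_mono order_trans)
  then have C: "norm C \<le> \<delta> * (2 * s)" by (simp add: algebra_simps)
  have ode: "?D 2 ?x t = cross3 (?D 1 ?x t) (?x t) + C" if "t \<in> {t0..t1}" for t
    unfolding C_def by (rule variation_quadratic[OF \<delta>'(3) that])
  have x': "norm (?D 1 ?x t) \<le> \<delta> * (s + 2 * s * T)" if t: "t \<in> {t0..t1}" for t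
  proof -
    have "norm (?D 1 ?x t) \<le> norm (?D 1 ?x t0) + \<delta> * (2 * s) * (t - t0)"
    proof (rule norm_le_cross_ode[where g = ?x and e = "\<lambda>_. C", OF _ C t])
      show "(?D 1 ?x has_vector_derivative cross3 (?D 1 ?x t) (?x t) + C) (at t within {t0..t1})"
        if "t \<in> {t0..t1}" for t
        using smooth_curve_nderiv[OF less x that, of 1] ode[OF that]
        by (simp add: numeral_2_eq_2)
    qed
    also have "\<dots> \<le> s * \<delta> + \<delta> * (2 * s) * T"
      using t s \<delta>' by (intro add_mono init mult_left_mono) (auto simp: T_def)
    finally show ?thesis by (simp add: algebra_simps)
  qed
  have u: "norm (?u t) \<le> \<delta> * (1 + (s + 2 * s * T) * T)" if t: "t \<in> {t0..t1}" for t
  proof -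
    have "norm (?u t) \<le> norm (?u t0) + \<delta> * (s + 2 * s * T) * (t - t0)"
    proof (rule norm_le_of_derivative_le[OF _ x' t])
      show "(?u has_vector_derivative ?D 1 ?x t) (at t within {t0..t1})" if "t \<in> {t0..t1}" for t
        using smooth_curve_nderiv[OF less smooth_curve_deviation(2) that, of 0] du[OF that, of 0]
        by (simp del: nderiv.simps(2))
    qed
    also have "\<dots> \<le> \<delta> * 1 + \<delta> * (s + 2 * s * T) * T"
    proof (intro add_mono mult_left_mono)
      \<comment> \<open>The initial value is affine in \<open>h\<close>, so the deviation starts at
        exactly \<delta> times the slope.\<close>
      show "norm (?u t0) \<le> \<delta> * 1"
        using variation_initial_affine[OF \<delta>'(3)] \<delta>'(1)
          mult_left_mono[OF norm_variation_slope \<delta>'(1)] by simp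
    qed (use t s T \<delta>' in \<open>auto simp: T_def\<close>)
    finally show ?thesis by (simp add: algebra_simps)
  qed
  have U0: "s + 2 * s * T \<le> ?U 0" "1 + (s + 2 * s * T) * T \<le> ?U 0" "2 * s \<le> ?U 0"
    using s T mult_nonneg_nonneg[OF s T] mult_nonneg_nonneg[OF mult_nonneg_nonneg[OF s T] T]
    by (simp_all add: algebra_simps)
  show "norm (?D i ?u t) \<le> \<delta> * ?U n" if "i \<le> Suc n" "t \<in> {t0..t1}"
    using that
  proof (induction n arbitrary: i t)
    case 0
    then consider "i = 0" | "i = 1" by linarith
    then show ?case
    proof cases
      case 1
      have "norm (?u t) \<le> \<delta> * ?U 0"
        by (rule order_trans[OF u[OF 0(2)] mult_left_mono[OF U0(2) \<delta>'(1)]])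
      with 1 show ?thesis by simp
    next
      case 2
      have "norm (?D 1 ?x t) \<le> \<delta> * ?U 0"
        by (rule order_trans[OF x'[OF 0(2)] mult_left_mono[OF U0(1) \<delta>'(1)]])
      with 2 du[OF 0(2), of 0] show ?thesis by simp
    qed
  next
    case (Suc n)
    have U: "0 \<le> ?U n" "?U 0 \<le> ?U n"
      using deviation_bound_nonneg[OF T s] deviation_bound_ge_0[OF T s] by auto
    have \<delta>U: "\<delta> * ?U n \<le> ?U n" using mult_right_mono[OF \<delta>'(2) U(1)] by simp
    show ?case
    proof (cases "i \<le> Suc n")
      case True
      have "norm (?D i ?u t) \<le> \<delta> * ?U n" by (rule Suc.IH[OF True Suc.prems(2)])
      also have "\<dots> \<le> \<delta> * ?U (Suc n)" using U \<delta>' by (intro mult_left_mono) auto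
      finally show ?thesis .
    next
      case False
      then have i: "i = Suc (Suc n)" using Suc.prems by simp
      \<comment> \<open>The curve itself is bounded only to order 1: the factor \<delta> in the
        cross product comes from its derivative.\<close>
      have x_le: "norm (?D k ?x t) \<le> 1 + ?U n" if "k \<le> n" for k
      proof -
        have "?D k ?x t = (if k = 0 then D else 0) + ?D k ?u t"
          using nderiv_deviation[OF Suc.prems(2), of k] by simp
        also have "norm \<dots> \<le> 1 + \<delta> * ?U n"
          using norm_constant Suc.IH[OF _ Suc.prems(2), of k] that
          by (intro norm_triangle_mono) auto
        finally show ?thesis using \<delta>U by simp
      qed
      have "norm (?D (Suc (Suc n)) ?x t) \<le> 2 ^ n * (\<delta> * ?U n * (1 + ?U n)) + \<delta> * ?U n"
      proof (rule norm_nderiv_cross_ode_le[OF less x x smooth_curve_const(2)[OF less] ode Suc.prems(2) _ x_le])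
        show "norm (?D (Suc k) ?x t) \<le> \<delta> * ?U n" if "k \<le> n" for k
          using Suc.IH[OF _ Suc.prems(2), of "Suc k"] du[OF Suc.prems(2), of k] that
          by (simp del: nderiv.simps)
        have "norm C \<le> \<delta> * ?U n"
          using order_trans[OF C mult_left_mono[OF order_trans[OF U0(3) U(2)] \<delta>'(1)]] .
        then show "norm (?D n (\<lambda>_. C) t) \<le> \<delta> * ?U n"
          using nderiv_const[OF less Suc.prems(2), of n C] U(1) \<delta>'(1)
          by (cases "n = 0") (auto simp del: deviation_bound.simps)
      qed
      then show ?thesis
        unfolding i du[OF Suc.prems(2)] by (simp add: algebra_simps del: nderiv.simps)
    qed
  qed
qed

lemma smooth_curve_remainder:
  shows nderiv_remainder: "t \<in> {t0..t1} \<Longrightarrow>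
      nderiv {t0..t1} j (\<lambda>t. V \<delta> t - approx1 t0 t1 V \<delta> t) t
        = nderiv {t0..t1} j (V \<delta>) t - nderiv {t0..t1} j (approx1 t0 t1 V \<delta>) t"
    and "smooth_curve t0 t1 (\<lambda>t. V \<delta> t - approx1 t0 t1 V \<delta> t)"
proof -
  have x: "smooth_curve t0 t1 (V \<delta>)"
    using \<delta> by (intro smooth_curve_variation) auto
  note y = smooth_curve_approx1(2)[of \<delta>]
  show "smooth_curve t0 t1 (\<lambda>t. V \<delta> t - approx1 t0 t1 V \<delta> t)"
    by (rule smooth_curve_diff(2)[OF less x y])
  show "t \<in> {t0..t1} \<Longrightarrow>
      nderiv {t0..t1} j (\<lambda>t. V \<delta> t - approx1 t0 t1 V \<delta> t) t
        = nderiv {t0..t1} j (V \<delta>) t - nderiv {t0..t1} j (approx1 t0 t1 V \<delta>) t"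
    by (rule nderiv_diff[OF less x y])
qed

text \<open>The forcing term of the remainder equation is quadratic in the deviation up to a
  constant of order \<delta>^2. The induction has the same shape as for the deviation, now with
  \<delta>^2 throughout.\<close>

lemma norm_remainder_le:
  "i \<le> Suc n \<Longrightarrow> t \<in> {t0..t1} \<Longrightarrow>
    norm (nderiv {t0..t1} i (\<lambda>t. V \<delta> t - approx1 t0 t1 V \<delta> t) t)
     \<le> \<delta>\<^sup>2 * remainder_bound (t1 - t0) (initial_size t0 t1 V) n"
proof -
  define s T where "s = initial_size t0 t1 V" and "T = t1 - t0"
  let ?x = "V \<delta>" and ?u = "\<lambda>t. V \<delta> t - D" and ?r = "\<lambda>t. V \<delta> t - approx1 t0 t1 V \<delta> t"
  let ?w = "\<lambda>j. mixed_deriv t0 t1 V 1 j 0"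
  let ?D = "nderiv {t0..t1}" and ?U = "deviation_bound T s" and ?R = "remainder_bound T s"
  have s: "0 \<le> s" and T: "0 \<le> T"
    using initial_size_nonneg less by (simp_all add: s_def T_def)
  have \<delta>': "0 \<le> \<delta>" "\<delta> \<le> 1" "\<delta> \<in> {-1..1}" using \<delta> by auto
  have t0: "t0 \<in> {t0..t1}" using less by simp
  note u = smooth_curve_deviation(2) and r = smooth_curve_remainder(2)
  note u_le = norm_deviation_le[folded s_def T_def]
  have du: "?D (Suc i) ?u t = ?D (Suc i) ?x t" if "t \<in> {t0..t1}" for i t
    using nderiv_deviation[OF that, of "Suc i"] by simp
  have dr: "?D i ?r t = ?D i ?x t - ((if i = 0 then D else 0) + \<delta> *\<^sub>R ?w i t)"
    if "t \<in> {t0..t1}" for i t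
    using nderiv_remainder[OF that] nderiv_approx1[OF that] by simp
  have dr1: "?D 1 ?r t = ?D 1 ?x t - \<delta> *\<^sub>R ?w 1 t" and dr2: "?D 2 ?r t = ?D 2 ?x t - \<delta> *\<^sub>R ?w 2 t"
    and du1: "?D 1 ?u t = ?D 1 ?x t" if "t \<in> {t0..t1}" for t
    using dr[OF that, of 1] dr[OF that, of 2] du[OF that, of 0] by simp_all
  \<comment> \<open>\<open>k\<close> is read off from the remainder equation at \<open>t0\<close>;
    \<open>ode\<close> confirms that it serves at all times.\<close>
  define k where "k = ?D 2 ?r t0 - cross3 (?D 1 ?r t0) D - cross3 (?D 1 ?u t0) (?u t0)"
  define e where "e = (\<lambda>t. cross3 (?D 1 ?u t) (?u t) + k)"
  \<comment> \<open>This rests on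
    \<open>x' \<times> x = x' \<times> D + x' \<times> (x - D)\<close>. The letters
    \<open>P\<close>, \<open>X\<close>, \<open>W\<close> stand for values at \<open>t\<close>, and
    \<open>p\<close>, \<open>p2\<close>, \<open>X0\<close>, \<open>w\<close>, \<open>w2\<close> for
    values at \<open>t0\<close>.\<close>
  have expand: "cross3 P X + (p2 - cross3 p X0) - \<delta> *\<^sub>R (cross3 W D + (w2 - cross3 w D))
    = cross3 (P - \<delta> *\<^sub>R W) D + (cross3 P (X - D)
      + ((p2 - \<delta> *\<^sub>R w2) - cross3 (p - \<delta> *\<^sub>R w) D - cross3 p (X0 - D)))" for P X p2 p X0 W w2 w
    by (simp add: Cross3.left_diff_distrib Cross3.right_diff_distrib cross_mult_left algebra_simps)
  have ode: "?D 2 ?r t = cross3 (?D 1 ?r t) D + e t" if t: "t \<in> {t0..t1}" for t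
    unfolding e_def k_def dr1[OF t] dr2[OF t] dr1[OF t0] dr2[OF t0] du1[OF t] du1[OF t0]
      variation_quadratic[OF \<delta>'(3) t] linearised_quadratic[OF t]
    by (rule expand)
  have init: "norm (?D 1 ?r t0) \<le> s * \<delta>\<^sup>2" "norm (?D 2 ?r t0) \<le> s * \<delta>\<^sup>2" "norm (?D 1 ?u t0) \<le> s * \<delta>"
    unfolding dr1[OF t0] dr2[OF t0] du1[OF t0]
    using norm_initial_deriv_le[OF _ \<delta>] by (auto simp: s_def simp del: nderiv.simps)
  have u0: "norm (?u t0) \<le> \<delta>"
    using variation_initial_affine[OF \<delta>'(3)] \<delta>'(1)
      mult_left_mono[OF norm_variation_slope \<delta>'(1)] by simp
  \<comment> \<open>The first two terms are Taylor remainders in \<open>h\<close>; the third is a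
    product of two factors of order \<delta>.\<close>
  have "norm k \<le> s * \<delta>\<^sup>2 + s * \<delta>\<^sup>2 * 1 + s * \<delta> * \<delta>"
    unfolding k_def
    by (intro norm_triangle_le_diff add_mono norm_cross3_mono init u0 norm_constant)
  then have k: "norm k \<le> \<delta>\<^sup>2 * (3 * s)" by (simp add: algebra_simps power2_eq_square)
  define Q where "Q = (?U 0)\<^sup>2 + 3 * s"
  have Q: "0 \<le> Q" using s by (simp add: Q_def)
  have e: "norm (e t) \<le> \<delta>\<^sup>2 * Q" if t: "t \<in> {t0..t1}" for t
  proof -
    have "norm (e t) \<le> (\<delta> * ?U 0) * (\<delta> * ?U 0) + \<delta>\<^sup>2 * (3 * s)"
      unfolding e_def using u_le[OF _ t, of 1 0] u_le[OF _ t, of 0 0]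
      by (intro norm_triangle_mono norm_cross3_mono k) simp_all
    then show ?thesis by (simp add: Q_def algebra_simps power2_eq_square)
  qed
  have r': "norm (?D 1 ?r t) \<le> \<delta>\<^sup>2 * (s + Q * T)" if t: "t \<in> {t0..t1}" for t
  proof -
    have "norm (?D 1 ?r t) \<le> norm (?D 1 ?r t0) + \<delta>\<^sup>2 * Q * (t - t0)"
    proof (rule norm_le_cross_ode[where g = "\<lambda>_. D" and e = e, OF _ e t])
      show "(?D 1 ?r has_vector_derivative cross3 (?D 1 ?r t) D + e t) (at t within {t0..t1})"
        if "t \<in> {t0..t1}" for t
        using smooth_curve_nderiv[OF less r that, of 1] ode[OF that]
        by (simp add: numeral_2_eq_2)
    qed
    also have "\<dots> \<le> s * \<delta>\<^sup>2 + \<delta>\<^sup>2 * Q * T"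
      using t Q by (intro add_mono init mult_left_mono) (auto simp: T_def)
    finally show ?thesis by (simp add: algebra_simps)
  qed
  have r0: "norm (?r t) \<le> \<delta>\<^sup>2 * ((s + Q * T) * T)" if t: "t \<in> {t0..t1}" for t
  proof -
    have "norm (?r t) \<le> norm (?r t0) + \<delta>\<^sup>2 * (s + Q * T) * (t - t0)"
    proof (rule norm_le_of_derivative_le[OF _ r' t])
      show "(?r has_vector_derivative ?D 1 ?r t) (at t within {t0..t1})" if "t \<in> {t0..t1}" for t
        using smooth_curve_nderiv[OF less r that, of 0] by simp
    qed
    \<comment> \<open>The remainder vanishes exactly at \<open>t0\<close>, because
      \<open>V h t0\<close> is affine in \<open>h\<close>.\<close>
    also have "norm (?r t0) = 0"
      using dr[OF t0, of 0] variation_initial_affine[OF \<delta>'(3)] by simp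
    also have "0 + \<delta>\<^sup>2 * (s + Q * T) * (t - t0) \<le> \<delta>\<^sup>2 * (s + Q * T) * T"
      using t s T Q by (auto simp: T_def intro!: mult_left_mono)
    finally show ?thesis by (simp add: algebra_simps)
  qed
  have "?R 0 = (1 + T) * (4 * s + T * Q)" by (simp add: Q_def)
  then have R0: "s + Q * T \<le> ?R 0" "(s + Q * T) * T \<le> ?R 0" "3 * s \<le> ?R 0"
    using s T Q mult_nonneg_nonneg[OF s T] mult_nonneg_nonneg[OF Q T]
      mult_nonneg_nonneg[OF mult_nonneg_nonneg[OF Q T] T]
    by (simp_all add: algebra_simps)
  show "norm (?D i ?r t) \<le> \<delta>\<^sup>2 * ?R n" if "i \<le> Suc n" "t \<in> {t0..t1}"
    using that
  proof (induction n arbitrary: i t)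
    case 0
    then consider "i = 0" | "i = 1" by linarith
    then show ?case
    proof cases
      case 1
      have "norm (?r t) \<le> \<delta>\<^sup>2 * ?R 0"
        by (rule order_trans[OF r0[OF 0(2)] mult_left_mono[OF R0(2)]]) simp
      with 1 show ?thesis by simp
    next
      case 2
      have "norm (?D 1 ?r t) \<le> \<delta>\<^sup>2 * ?R 0"
        by (rule order_trans[OF r'[OF 0(2)] mult_left_mono[OF R0(1)]]) simp
      with 2 show ?thesis by simp
    qed
  next
    case (Suc n)
    note t = Suc.prems(2)
    have R: "0 \<le> ?R n" "?R 0 \<le> ?R n"
      using remainder_bound_nonneg[OF T s] remainder_bound_ge_0[OF T s] by auto
    show ?case
    proof (cases "i \<le> Suc n")
      case True
      have "norm (?D i ?r t) \<le> \<delta>\<^sup>2 * ?R n" by (rule Suc.IH[OF True t])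
      also have "\<dots> \<le> \<delta>\<^sup>2 * ?R (Suc n)" using R by (intro mult_left_mono) auto
      finally show ?thesis .
    next
      case False
      then have i: "i = Suc (Suc n)" using Suc.prems by simp
      note u1 = smooth_curve_nderiv_1[OF less u]
      note uu = smooth_curve_cross3[OF less u1 u] and const = smooth_curve_const(2)[OF less]
      have e_smooth: "smooth_curve t0 t1 e"
        unfolding e_def by (rule smooth_curve_add(2)[OF less uu const])
      have de: "?D n e t = ?D n (\<lambda>t. cross3 (?D 1 ?u t) (?u t)) t + ?D n (\<lambda>_. k) t"
        unfolding e_def by (rule nderiv_add[OF less uu const t])
      have "norm k \<le> \<delta>\<^sup>2 * ?R n"
        using order_trans[OF k mult_left_mono[OF order_trans[OF R0(3) R(2)]]] by simp
      then have dk: "norm (?D n (\<lambda>_. k) t) \<le> \<delta>\<^sup>2 * ?R n"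
        using nderiv_const[OF less t, of n k] R(1)
        by (cases "n = 0") (auto simp del: remainder_bound.simps)
      have "norm (?D j (?D 1 ?u) t) \<le> \<delta> * ?U n" if "j \<le> n" for j
        using u_le[OF _ t, of "Suc j" n] that unfolding nderiv_Suc_shift by simp
      \<comment> \<open>Both factors of the quadratic term carry a factor \<delta> at every order of
        differentiation.\<close>
      then have de_le: "norm (?D n e t) \<le> 2 ^ n * ((\<delta> * ?U n) * (\<delta> * ?U n)) + \<delta>\<^sup>2 * ?R n"
        unfolding de
        by (intro norm_triangle_mono dk norm_nderiv_cross3_le[OF less u1 u _ _ t] u_le t) simp_all
      \<comment> \<open>Here \<open>g\<close> is the constant \<open>D\<close>. The factor 1 bounds
        it together with its vanishing derivatives.\<close>
      have "norm (?D (Suc (Suc n)) ?r t) \<le> 2 ^ n * ((\<delta>\<^sup>2 * ?R n) * 1)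
          + (2 ^ n * ((\<delta> * ?U n) * (\<delta> * ?U n)) + \<delta>\<^sup>2 * ?R n)"
      proof (rule norm_nderiv_cross_ode_le[OF less r const e_smooth ode t _ _ de_le])
        show "norm (?D (Suc j) ?r t) \<le> \<delta>\<^sup>2 * ?R n" if "j \<le> n" for j
          using Suc.IH[OF _ t, of "Suc j"] that by simp
        show "norm (?D j (\<lambda>_. D) t) \<le> 1" for j
          using nderiv_const[OF less t, of j D] norm_constant by simp
      qed
      then show ?thesis
        unfolding i by (simp add: algebra_simps power2_eq_square del: nderiv.simps)
    qed
  qed
qed

end
end

section \<open>Closed form and error bound, uniformly over all variations\<close>

theorem theorem2:
  fixes t0 t1 d :: real
  assumes "t0 < t1"
  shows "(\<forall>(D :: real^3) V. variation t0 t1 D V \<and> norm D = d \<longrightarrow>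
      (\<exists>c0 c1 c2. \<exists>A0 \<in> orthogonal_comp {D /\<^sub>R d}. \<exists>A1 \<in> orthogonal_comp {D /\<^sub>R d}.
        \<exists>B \<in> orthogonal_comp {D /\<^sub>R d}. \<forall>\<delta>\<in>{0<..<1}. \<forall>t\<in>{t0..t1}.
          approx1 t0 t1 V \<delta> t =
            D + \<delta> *\<^sub>R ((c0 + c1 * (t - t0) + c2 * (t - t0)\<^sup>2) *\<^sub>R (D /\<^sub>R d)
                      + A0 + (t - t0) *\<^sub>R A1 + e_tilde t0 D t B))) \<and>
    (\<exists>M :: nat \<Rightarrow> real \<Rightarrow> real. (\<forall>j. mono (M j)) \<and>
      (\<forall>(D :: real^3) V. variation t0 t1 D V \<and> norm D = d \<longrightarrow>
        (\<forall>j. \<forall>\<delta>\<in>{0<..<1}. \<forall>t\<in>{t0..t1}.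
          norm (nderiv {t0..t1} j (V \<delta>) t - nderiv {t0..t1} j (approx1 t0 t1 V \<delta>) t)
            \<le> M j (initial_size t0 t1 V) * \<delta>\<^sup>2)))"
proof (rule conjI, goal_cases)
  case 1
  show ?case
  proof (intro allI impI, elim conjE)
    fix D :: "real^3" and V
    assume var: "variation t0 t1 D V" and d: "norm D = d"
    from approx1_closed_form[OF assms var, unfolded d]
    show "\<exists>c0 c1 c2. \<exists>A0 \<in> orthogonal_comp {D /\<^sub>R d}. \<exists>A1 \<in> orthogonal_comp {D /\<^sub>R d}.
        \<exists>B \<in> orthogonal_comp {D /\<^sub>R d}. \<forall>\<delta>\<in>{0<..<1}. \<forall>t\<in>{t0..t1}.
          approx1 t0 t1 V \<delta> t =
            D + \<delta> *\<^sub>R ((c0 + c1 * (t - t0) + c2 * (t - t0)\<^sup>2) *\<^sub>R (D /\<^sub>R d)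
                      + A0 + (t - t0) *\<^sub>R A1 + e_tilde t0 D t B)"
      by blast
  qed
next
  case 2
  \<comment> \<open>For a fixed interval and order, the constant sees the variation only through its
    initial size. Monotonicity was shown for nonnegative sizes, so \<open>max 0\<close> extends it
    to all reals; it changes nothing at \<open>initial_size\<close>, which is nonnegative.\<close>
  let ?M = "\<lambda>j s. remainder_bound (t1 - t0) (max 0 s) j"
  have "mono (?M j)" for j
    using assms by (intro monoI remainder_bound_mono) auto
  moreover have "norm (nderiv {t0..t1} j (V \<delta>) t - nderiv {t0..t1} j (approx1 t0 t1 V \<delta>) t)
      \<le> ?M j (initial_size t0 t1 V) * \<delta>\<^sup>2"
    if var: "variation t0 t1 D V" and \<delta>: "\<delta> \<in> {0<..<1}" and t: "t \<in> {t0..t1}" for D V j \<delta> t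
    \<comment> \<open>Step \<open>j\<close> covers all orders up to \<open>j + 1\<close>, in
      particular order \<open>j\<close>.\<close>
    using norm_remainder_le[OF assms var \<delta> _ t, of j j] initial_size_nonneg[OF assms var]
    unfolding nderiv_remainder[OF assms var \<delta> t] by (simp add: mult.commute)
  ultimately show ?case
    by (intro exI[of _ ?M]) blast
qed

end
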